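(* Let $\mathcal{H}$ be a complex Hilbert space and let $A,B\in\mathcal{B}(\mathcal{H})$. Then $$dw\begin{pmatrix} 0 & A\\ B & 0\end{pmatrix}\leq\begin{cases}\dfrac{\|A\|}{2\sqrt{1-\|A\|^2}}+\dfrac{\|B\|}{2\sqrt{1-\|B\|^2}}, & \|A\|<\frac{1}{\sqrt{2}},\ \|B\|<\frac{1}{\sqrt{2}},\\[2mm] \dfrac{\|A\|}{2\sqrt{1-\|A\|^2}}+\|B\|^2, & \|A\|<\frac{1}{\sqrt{2}},\ \|B\|\geq\frac{1}{\sqrt{2}},\\[2mm] \|A\|^2+\dfrac{\|B\|}{2\sqrt{1-\|B\|^2}}, & \|A\|\geq\frac{1}{\sqrt{2}},\ \|B\|<\frac{1}{\sqrt{2}},\\[2mm] \|A\|^2+\|B\|^2, & \|A\|\geq\frac{1}{\sqrt{2}},\ \|B\|\geq\frac{1}{\sqrt{2}}.\end{cases}$$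
   Context: $\mathcal{B}(\mathcal{H})$ is the algebra of bounded linear operators on the complex Hilbert space $\mathcal{H}$, with operator norm $\|\cdot\|$. A $2\times2$ operator matrix acts on the Hilbert space direct sum $\mathcal{H}\oplus\mathcal{H}$ (norm $\|(x,y)\|^2=\|x\|^2+\|y\|^2$) in the usual way. For a bounded operator $T$ on a complex Hilbert space, the Davis-Wielandt radius is $dw(T)=\sup\{\sqrt{|\langle Tz,z\rangle|^2+\|Tz\|^4}: \|z\|=1\}$. *)

theory Defs
  imports "HOL-Analysis.Analysis"
begin

section \<open>Complex Hilbert spaces\<close>

text \<open>
  A complex inner product space is a real normed space with a compatible complex scalar
  multiplication and a Hermitian inner product that induces the given norm. The inner product is
  linear in its first argument. Superclassing \<^class>\<open>real_normed_vector\<close> makes the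
  triangle inequality an axiom, although it already follows from the others.
\<close>

class complex_vector = real_vector +
  fixes scaleC :: "complex \<Rightarrow> 'a \<Rightarrow> 'a"  (infixr \<open>*\<^sub>C\<close> 75)
  assumes scaleC_add_right: "c *\<^sub>C (x + y) = c *\<^sub>C x + c *\<^sub>C y"
    and scaleC_add_left: "(c + d) *\<^sub>C x = c *\<^sub>C x + d *\<^sub>C x"
    and scaleC_scaleC: "c *\<^sub>C d *\<^sub>C x = (c * d) *\<^sub>C x"
    and scaleC_one: "1 *\<^sub>C x = x"
    and scaleR_scaleC: "r *\<^sub>R x = complex_of_real r *\<^sub>C x"

class complex_inner = complex_vector + real_normed_vector +
  fixes cinner :: "'a \<Rightarrow> 'a \<Rightarrow> complex"
  assumes cinner_commute: "cinner x y = cnj (cinner y x)"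
    and cinner_add_left: "cinner (x + y) z = cinner x z + cinner y z"
    and cinner_scaleC_left: "cinner (c *\<^sub>C x) y = c * cinner x y"
    and cinner_ge_zero: "0 \<le> Re (cinner x x)"
    and cinner_eq_zero_iff: "cinner x x = 0 \<longleftrightarrow> x = 0"
    and norm_eq_sqrt_cinner: "norm x = sqrt (Re (cinner x x))"

class chilbert_space = complex_inner + complete_space

lemma cinner_add_right: "cinner x (y + z) = cinner x y + cinner x z"
  for x y z :: "'a::complex_inner"
  by (metis cinner_commute cinner_add_left complex_cnj_add)

lemma cinner_scaleC_right: "cinner x (c *\<^sub>C y) = cnj c * cinner x y"
  for x y :: "'a::complex_inner"
  by (metis cinner_commute cinner_scaleC_left complex_cnj_mult)

lemma cinner_self: "cinner x x = complex_of_real ((norm x)\<^sup>2)"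
  for x :: "'a::complex_inner"
proof -
  have "Im (cinner x x) = 0"
    using arg_cong[OF cinner_commute[of x x], of Im] by simp
  moreover have "Re (cinner x x) = (norm x)\<^sup>2"
    by (simp add: norm_eq_sqrt_cinner cinner_ge_zero)
  ultimately show ?thesis
    by (simp add: complex_eq_iff)
qed

lemma cinner_Cauchy_Schwarz: "cmod (cinner x y) \<le> norm x * norm y"
  for x y :: "'a::complex_inner"
proof (cases "y = 0")
  case True
  have "cinner x 0 = 0"
    using cinner_add_right[of x 0 0] by simp
  then show ?thesis using True by simp
next
  case False
  define n where "n = (norm y)\<^sup>2"
  define a where "a = cinner x y"
  define c where "c = - (a / of_real n)"
  have n: "n > 0" using False by (simp add: n_def)
  have yx: "cinner y x = cnj a"
    unfolding a_def by (rule cinner_commute)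
  have "cinner (x + c *\<^sub>C y) (x + c *\<^sub>C y)
      = cinner x x + cnj c * a + c * cnj a + c * cnj c * cinner y y"
    by (simp add: cinner_add_left cinner_add_right cinner_scaleC_left cinner_scaleC_right
        yx a_def[symmetric] algebra_simps)
  also have "\<dots> = cinner x x - a * cnj a / of_real n"
    using n by (simp add: cinner_self[of y] n_def[symmetric] c_def)
  also have "\<dots> = of_real ((norm x)\<^sup>2 - (cmod a)\<^sup>2 / n)"
    by (simp add: cinner_self complex_norm_square[symmetric] flip: of_real_power)
  finally have "Re (of_real ((norm x)\<^sup>2 - (cmod a)\<^sup>2 / n)) \<ge> 0"
    using cinner_ge_zero[of "x + c *\<^sub>C y"] by simp
  then have "(cmod a)\<^sup>2 \<le> (norm x * norm y)\<^sup>2"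
    using n by (simp add: field_simps n_def)
  then show ?thesis
    unfolding a_def by (rule power2_le_imp_le) simp
qed

instantiation complex :: chilbert_space
begin

definition scaleC_complex_def: "c *\<^sub>C (z::complex) = c * z"
definition cinner_complex_def: "cinner w (z::complex) = w * cnj z"

instance
proof
  fix x :: complex
  show "0 \<le> Re (cinner x x)"
    by (simp add: cinner_complex_def)
  show "norm x = sqrt (Re (cinner x x))"
    by (simp add: cinner_complex_def cmod_def power2_eq_square)
qed (auto simp: scaleC_complex_def cinner_complex_def algebra_simps scaleR_conv_of_real)

end

text \<open>
  The Hilbert space direct sum is the product type: its norm is already
  \<open>sqrt ((norm x)\<^sup>2 + (norm y)\<^sup>2)\<close>.
\<close>

instantiation prod :: (complex_vector, complex_vector) complex_vector
begin

definition scaleC_prod_def: "c *\<^sub>C x = (c *\<^sub>C fst x, c *\<^sub>C snd x)"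

instance
  by standard (auto simp: scaleC_prod_def scaleC_add_right scaleC_add_left scaleC_scaleC
      scaleC_one scaleR_prod_def scaleR_scaleC)

end

instantiation prod :: (complex_inner, complex_inner) complex_inner
begin

definition cinner_prod_def: "cinner x y = cinner (fst x) (fst y) + cinner (snd x) (snd y)"

instance
proof
  fix x y z :: "'a \<times> 'b" and c :: complex
  show "cinner x y = cnj (cinner y x)"
    by (simp add: cinner_prod_def flip: cinner_commute)
  show "cinner (x + y) z = cinner x z + cinner y z"
    by (simp add: cinner_prod_def cinner_add_left)
  show "cinner (c *\<^sub>C x) y = c * cinner x y"
    by (simp add: cinner_prod_def scaleC_prod_def cinner_scaleC_left algebra_simps)
  have self: "cinner x x = of_real ((norm x)\<^sup>2)"
    by (simp add: cinner_prod_def norm_prod_def cinner_self)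
  show "0 \<le> Re (cinner x x)" "cinner x x = 0 \<longleftrightarrow> x = 0" "norm x = sqrt (Re (cinner x x))"
    by (simp_all add: self del: of_real_power)
qed

end

instance prod :: (chilbert_space, chilbert_space) chilbert_space ..

section \<open>Bounded operators and the Davis--Wielandt radius\<close>

locale bounded_clinear = bounded_linear f
  for f :: "'a::complex_inner \<Rightarrow> 'b::complex_inner" +
  assumes scaleC: "f (c *\<^sub>C x) = c *\<^sub>C f x"

definition op_matrix ::
  "('a \<Rightarrow> 'c) \<Rightarrow> ('b \<Rightarrow> 'c) \<Rightarrow> ('a \<Rightarrow> 'd) \<Rightarrow> ('b \<Rightarrow> 'd) \<Rightarrow>
    'a::complex_inner \<times> 'b::complex_inner \<Rightarrow> 'c::complex_inner \<times> 'd::complex_inner"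
  where "op_matrix P Q R S = (\<lambda>(x, y). (P x + Q y, R x + S y))"

text \<open>
  The supremum is taken in the nonnegative reals. Inserting \<open>0\<close> only matters on the zero space,
  where there are no unit vectors and the real \<^const>\<open>Sup\<close> of the empty set is unspecified;
  see \<open>dw_eq_SUP\<close> below.
\<close>

definition dw :: "('a::complex_inner \<Rightarrow> 'a) \<Rightarrow> real"
  where "dw T = Sup (insert 0
    ((\<lambda>z. sqrt ((cmod (cinner (T z) z))\<^sup>2 + norm (T z) ^ 4)) ` {z. norm z = 1}))"

lemma bdd_above_dw:
  fixes T :: "'a::complex_inner \<Rightarrow> 'a"
  assumes "bounded_clinear T"
  shows "bdd_above ((\<lambda>z. sqrt ((cmod (cinner (T z) z))\<^sup>2 + norm (T z) ^ 4)) ` {z. norm z = 1})"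
proof (rule bdd_aboveI2)
  interpret bounded_clinear T by fact
  fix z :: 'a assume "z \<in> {z. norm z = 1}"
  then have z: "norm z = 1" by simp
  have T: "norm (T z) \<le> onorm T"
    using onorm[OF bounded_linear_axioms, of z] z by simp
  moreover have "cmod (cinner (T z) z) \<le> onorm T"
    using cinner_Cauchy_Schwarz[of "T z" z] T z by simp
  ultimately show "sqrt ((cmod (cinner (T z) z))\<^sup>2 + norm (T z) ^ 4)
      \<le> sqrt ((onorm T)\<^sup>2 + onorm T ^ 4)"
    by (intro real_sqrt_le_mono add_mono power_mono) auto
qed

lemma dw_eq_SUP:
  fixes T :: "'a::complex_inner \<Rightarrow> 'a"
  assumes "bounded_clinear T" and "(x::'a) \<noteq> 0"
  shows "dw T = (SUP z\<in>{z. norm z = 1}. sqrt ((cmod (cinner (T z) z))\<^sup>2 + norm (T z) ^ 4))"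
proof -
  let ?f = "\<lambda>z. sqrt ((cmod (cinner (T z) z))\<^sup>2 + norm (T z) ^ 4)"
  have bdd: "bdd_above (?f ` {z. norm z = 1})"
    using assms(1) by (rule bdd_above_dw)
  have u: "sgn x \<in> {z. norm z = 1}"
    using assms(2) by (simp add: norm_sgn)
  have "0 \<le> ?f (sgn x)" by simp
  also have "?f (sgn x) \<le> (SUP z\<in>{z. norm z = 1}. ?f z)"
    by (rule cSUP_upper[OF u bdd])
  finally have "0 \<le> (SUP z\<in>{z. norm z = 1}. ?f z)" .
  moreover have "?f ` {z. norm z = 1} \<noteq> {}"
    using u by blast
  ultimately show ?thesis
    unfolding dw_def using bdd by (simp add: cSup_insert sup_max)
qed

end

theory Submission
  imports Defs
begin

text \<open>
  For a unit vector \<open>z = (x, y)\<close>, the image of \<open>z\<close> is the orthogonal sum of \<open>(A y, 0)\<close> and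
  \<open>(0, B x)\<close>. So the vector in the plane with coordinates \<open>|\<langle>Tz, z\<rangle>|\<close> and \<open>\<parallel>Tz\<parallel>\<^sup>2\<close> is dominated by
  the sum of the corresponding vectors of the two nilpotent parts, and the triangle inequality
  reduces the claim to one nilpotent part. There, with \<open>u = \<parallel>y\<parallel>\<^sup>2\<close>, one maximises
  \<open>\<parallel>A\<parallel>\<^sup>2 u (1 - (1 - \<parallel>A\<parallel>\<^sup>2) u)\<close> over \<open>u \<in> [0, 1]\<close>.
\<close>

text \<open>For \<open>a \<ge> 0\<close> this is the square root of the maximum of
  \<open>a\<^sup>2 * (u * (1 - (1 - a\<^sup>2) * u))\<close> over \<open>u\<close> in [0, 1]. The
  first branch is the value at the vertex \<open>u = 1 / (2 * (1 - a\<^sup>2))\<close>, which lies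
  inside the interval exactly when \<open>a < 1 / sqrt 2\<close>; the second is the value at the
  endpoint \<open>u = 1\<close>.\<close>

definition nilpotent_bound :: "real \<Rightarrow> real"
  where "nilpotent_bound a = (if a < 1 / sqrt 2 then a / (2 * sqrt (1 - a\<^sup>2)) else a\<^sup>2)"

lemma less_inverse_sqrt2_iff:
  fixes a :: real
  assumes "0 \<le> a"
  shows "a < 1 / sqrt 2 \<longleftrightarrow> a\<^sup>2 < 1 / 2"
proof -
  have "1 / sqrt 2 = sqrt (1 / 2 :: real)"
    by (simp add: real_sqrt_divide)
  then show ?thesis
    using assms real_sqrt_less_iff[of "a\<^sup>2" "1 / 2"] by simp
qed

lemma nilpotent_bound_nonneg:
  assumes "0 \<le> a"
  shows "0 \<le> nilpotent_bound a"
  using assms less_inverse_sqrt2_iff[OF assms] by (simp add: nilpotent_bound_def)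

lemma quadratic_le_nilpotent_bound:
  assumes "0 \<le> a" "0 \<le> u" "u \<le> 1"
  shows "a\<^sup>2 * (u * (1 - (1 - a\<^sup>2) * u)) \<le> (nilpotent_bound a)\<^sup>2"
proof (cases "a < 1 / sqrt 2")
  case True
  define c where "c = 1 - a\<^sup>2"
  have c: "c > 0"
    using True less_inverse_sqrt2_iff[OF assms(1)] by (simp add: c_def)
  \<comment> \<open>Completing the square: \<open>1 / (4 * c) - u * (1 - c * u) = (2 * c * u -
    1)\<^sup>2 / (4 * c)\<close>.\<close>
  have "0 \<le> (2 * c * u - 1)\<^sup>2" by simp
  then have "u * (1 - c * u) \<le> 1 / (4 * c)"
    using c by (simp add: field_simps power2_eq_square)
  then have "a\<^sup>2 * (u * (1 - c * u)) \<le> a\<^sup>2 * (1 / (4 * c))"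
    by (rule mult_left_mono) simp
  also have "\<dots> = (nilpotent_bound a)\<^sup>2"
    using True c by (simp add: nilpotent_bound_def c_def power_divide power_mult_distrib)
  finally show ?thesis by (simp add: c_def)
next
  case False
  then have a: "1 / 2 \<le> a\<^sup>2"
    using less_inverse_sqrt2_iff[OF assms(1)] by simp
  have "1 / 2 * (1 + u) \<le> a\<^sup>2 * (1 + u)"
    using a assms by (intro mult_right_mono) auto
  then have "u \<le> a\<^sup>2 * (1 + u)"
    using assms by argo
  \<comment> \<open>This product is the gap
    \<open>a\<^sup>2 - u * (1 - (1 - a\<^sup>2) * u)\<close>, factored through its root
    \<open>u = 1\<close>.\<close>
  then have "0 \<le> (1 - u) * (a\<^sup>2 * (1 + u) - u)"
    using assms by (intro mult_nonneg_nonneg) auto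
  then have "u * (1 - (1 - a\<^sup>2) * u) \<le> a\<^sup>2"
    by (simp add: algebra_simps power2_eq_square)
  then have "a\<^sup>2 * (u * (1 - (1 - a\<^sup>2) * u)) \<le> a\<^sup>2 * a\<^sup>2"
    by (rule mult_left_mono) simp
  then show ?thesis
    using False by (simp add: nilpotent_bound_def power2_eq_square)
qed

lemma nilpotent_part_le:
  fixes A :: "'a::complex_inner \<Rightarrow> 'b::complex_inner"
  assumes "bounded_clinear A" and xy: "(norm x)\<^sup>2 + (norm y)\<^sup>2 = 1"
  shows "sqrt ((cmod (cinner (A y) x))\<^sup>2 + ((norm (A y))\<^sup>2)\<^sup>2) \<le> nilpotent_bound (onorm A)"
proof (rule real_le_lsqrt)
  interpret bounded_clinear A by fact
  define a u where "a = onorm A" and "u = (norm y)\<^sup>2"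
  have a: "0 \<le> a"
    unfolding a_def by (rule onorm_pos_le[OF bounded_linear_axioms])
  have x: "(norm x)\<^sup>2 = 1 - u" and u: "0 \<le> u" "u \<le> 1"
    using xy zero_le_power2[of "norm x"] zero_le_power2[of "norm y"] unfolding u_def by linarith+
  have "(norm (A y))\<^sup>2 \<le> (a * norm y)\<^sup>2"
    unfolding a_def by (intro power_mono onorm[OF bounded_linear_axioms]) simp
  then have Ay: "(norm (A y))\<^sup>2 \<le> a\<^sup>2 * u"
    by (simp add: u_def power_mult_distrib)
  have "(cmod (cinner (A y) x))\<^sup>2 \<le> (norm (A y) * norm x)\<^sup>2"
    by (intro power_mono cinner_Cauchy_Schwarz) simp
  also have "\<dots> \<le> a\<^sup>2 * u * (1 - u)"
    using Ay u by (simp add: power_mult_distrib x mult_right_mono)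
  finally have "(cmod (cinner (A y) x))\<^sup>2 \<le> a\<^sup>2 * u * (1 - u)" .
  moreover have "((norm (A y))\<^sup>2)\<^sup>2 \<le> (a\<^sup>2 * u)\<^sup>2"
    using Ay by (rule power_mono) simp
  \<comment> \<open>The two bounds add up to
    \<open>a\<^sup>2 * u * (1 - u) + a^4 * u\<^sup>2\<close>, which is the quadratic just
    maximised.\<close>
  ultimately have "(cmod (cinner (A y) x))\<^sup>2 + ((norm (A y))\<^sup>2)\<^sup>2
      \<le> a\<^sup>2 * (u * (1 - (1 - a\<^sup>2) * u))"
    by (simp add: algebra_simps power2_eq_square)
  also have "\<dots> \<le> (nilpotent_bound a)\<^sup>2"
    using a u by (rule quadratic_le_nilpotent_bound)
  finally show "(cmod (cinner (A y) x))\<^sup>2 + ((norm (A y))\<^sup>2)\<^sup>2 \<le> (nilpotent_bound (onorm A))\<^sup>2"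
    by (simp add: a_def)
  show "0 \<le> nilpotent_bound (onorm A)"
    using a nilpotent_bound_nonneg by (simp add: a_def)
qed

lemma dw_offdiag_le:
  fixes A :: "'b::complex_inner \<Rightarrow> 'a::complex_inner" and B :: "'a \<Rightarrow> 'b"
  assumes A: "bounded_clinear A" and B: "bounded_clinear B"
  shows "dw (op_matrix (\<lambda>_. 0) A B (\<lambda>_. 0)) \<le> nilpotent_bound (onorm A) + nilpotent_bound (onorm B)"
  unfolding dw_def
proof (rule cSup_least)
  interpret A: bounded_clinear A by fact
  interpret B: bounded_clinear B by fact
  let ?T = "op_matrix (\<lambda>_. 0) A B (\<lambda>_. 0)"
  let ?f = "\<lambda>z. sqrt ((cmod (cinner (?T z) z))\<^sup>2 + norm (?T z) ^ 4)"
  fix r assume "r \<in> insert 0 (?f ` {z. norm z = 1})"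
  then consider "r = 0" | z where "norm z = 1" "r = ?f z" by blast
  then show "r \<le> nilpotent_bound (onorm A) + nilpotent_bound (onorm B)"
  proof cases
    case 1
    then show ?thesis
      using onorm_pos_le[OF A.bounded_linear_axioms] onorm_pos_le[OF B.bounded_linear_axioms]
      by (simp add: nilpotent_bound_nonneg)
  next
    case 2
    obtain x y where z: "z = (x, y)" by (cases z)
    define p q where "p = A y" and "q = B x"
    have xy: "(norm x)\<^sup>2 + (norm y)\<^sup>2 = 1"
      using 2(1) by (simp add: z norm_prod_def)
    have T: "?T z = (p, q)"
      by (simp add: op_matrix_def z p_def q_def)
    have n4: "norm (p, q) ^ 4 = ((norm p)\<^sup>2 + (norm q)\<^sup>2)\<^sup>2"
    proof -
      have "norm (p, q) ^ 4 = ((norm (p, q))\<^sup>2)\<^sup>2" by simp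
      then show ?thesis by (simp add: norm_prod_def)
    qed
    have "cmod (cinner (p, q) (x, y)) \<le> cmod (cinner p x) + cmod (cinner q y)"
      by (simp add: cinner_prod_def norm_triangle_ineq)
    then have "r \<le> sqrt ((cmod (cinner p x) + cmod (cinner q y))\<^sup>2 + ((norm p)\<^sup>2 + (norm q)\<^sup>2)\<^sup>2)"
      unfolding 2(2) T n4 unfolding z by (intro real_sqrt_le_mono add_mono power_mono) auto
    \<comment> \<open>Minkowski's inequality in the plane; the second coordinates add exactly
      because \<open>(p, 0)\<close> and \<open>(0, q)\<close> are orthogonal.\<close>
    also have "\<dots> \<le> sqrt ((cmod (cinner p x))\<^sup>2 + ((norm p)\<^sup>2)\<^sup>2)
        + sqrt ((cmod (cinner q y))\<^sup>2 + ((norm q)\<^sup>2)\<^sup>2)"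
      by (rule real_sqrt_sum_squares_triangle_ineq)
    \<comment> \<open>\<open>B\<close> acts on \<open>x\<close> and is paired with \<open>y\<close>,
      so its estimate exchanges the roles of \<open>x\<close> and \<open>y\<close>.\<close>
    also have "\<dots> \<le> nilpotent_bound (onorm A) + nilpotent_bound (onorm B)"
      unfolding p_def q_def
      using nilpotent_part_le[OF A xy] nilpotent_part_le[OF B, of y x] xy
      by (intro add_mono) (simp_all add: add.commute)
    finally show ?thesis .
  qed
qed simp

theorem theorem3p12:
  fixes A B :: "'a::chilbert_space \<Rightarrow> 'a"
  assumes "bounded_clinear A" and "bounded_clinear B"
  shows "dw (op_matrix (\<lambda>_. 0) A B (\<lambda>_. 0)) \<le>
    (if onorm A < 1 / sqrt 2 \<and> onorm B < 1 / sqrt 2 then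
       onorm A / (2 * sqrt (1 - (onorm A)\<^sup>2)) + onorm B / (2 * sqrt (1 - (onorm B)\<^sup>2))
     else if onorm A < 1 / sqrt 2 \<and> onorm B \<ge> 1 / sqrt 2 then
       onorm A / (2 * sqrt (1 - (onorm A)\<^sup>2)) + (onorm B)\<^sup>2
     else if onorm A \<ge> 1 / sqrt 2 \<and> onorm B < 1 / sqrt 2 then
       (onorm A)\<^sup>2 + onorm B / (2 * sqrt (1 - (onorm B)\<^sup>2))
     else (onorm A)\<^sup>2 + (onorm B)\<^sup>2)"
  using dw_offdiag_le[OF assms] by (auto simp: nilpotent_bound_def split: if_splits)

end
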